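(* Let $\rho>0$, let $f:\mathbb{R}^n\to\mathbb{R}$, $g:\mathbb{R}^n\to\mathbb{R}^m$, $h:\mathbb{R}^n\to\mathbb{R}^p$ be twice continuously differentiable, and let $\phi$ be either the minimum function or the Fischer-Burmeister function. Let $x\in\mathbb{R}^n$, $\lambda\in\mathbb{R}^m$, $\mu\in\mathbb{R}^p$, $\gamma\in\mathbb{R}^n$ and set $y=e-\frac{\gamma\circ x}{\rho}$. Then $T$ is BD-regular in $(x,y,\lambda,\mu,\gamma)$ if and only if $T_{red}$ is BD-regular in $(x,\lambda,\mu,\gamma)$.
   Context: $e=(1,\dots,1)^T\in\mathbb{R}^n$; $\circ$ is the componentwise product; $L^{SP}(x,\lambda,\mu)=f(x)+\lambda^Tg(x)+\mu^Th(x)$. Minimum function: $\phi_m(a,b)=\min\{a,b\}$. Fischer-Burmeister function: $\phi_{FB}(a,b)=\sqrt{a^2+b^2}-a-b$. Put $(\Phi_g)_i(x,\lambda)=\phi(-g_i(x),\lambda_i)$, $i=1,\dots,m$. Define $$T(x,y,\lambda,\mu,\gamma)=\begin{pmatrix}\nabla_xL^{SP}(x,\lambda,\mu)+\gamma\circ y\\ \rho(y-e)+\gamma\circ x\\ \Phi_g(x,\lambda)\\ h(x)\\ x\circ y\end{pmatrix},\qquad T_{red}(x,\lambda,\mu,\gamma)=\begin{pmatrix}\nabla_xL^{SP}(x,\lambda,\mu)+\gamma\circ\left(e-\frac{\gamma\circ x}{\rho}\right)\\ \Phi_g(x,\lambda)\\ h(x)\\ x\circ\left(e-\frac{\gamma\circ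 x}{\rho}\right)\end{pmatrix}$$ for $x,y,\gamma\in\mathbb{R}^n$, $\lambda\in\mathbb{R}^m$, $\mu\in\mathbb{R}^p$. For a locally Lipschitz $F:\mathbb{R}^N\to\mathbb{R}^N$ with set of differentiability points $D_F$, the B-subdifferential at $z$ is $\partial_BF(z)=\{H\mid \exists\,\{z^k\}\subseteq D_F:\ z^k\to z,\ F'(z^k)\to H\}$; $F$ is BD-regular in $z$ if all elements of $\partial_BF(z)$ are nonsingular. *)

theory Defs
  imports "HOL-Analysis.Analysis"
begin

definition twice_cont_differentiable ::
    "('a::real_normed_vector \<Rightarrow> 'b::real_normed_vector) \<Rightarrow> bool" where
  "twice_cont_differentiable F \<longleftrightarrow>
     (\<exists>(F' :: 'a \<Rightarrow> 'a \<Rightarrow>\<^sub>L 'b) (F'' :: 'a \<Rightarrow> 'a \<Rightarrow>\<^sub>L ('a \<Rightarrow>\<^sub>L 'b)).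
        (\<forall>x. (F has_derivative blinfun_apply (F' x)) (at x)) \<and>
        (\<forall>x. (F' has_derivative blinfun_apply (F'' x)) (at x)) \<and>
        continuous_on UNIV F'')"

text \<open>Unspecified where the function is not differentiable; it is only applied to differentiable
  functions below.\<close>
definition gradient :: "('a::real_inner \<Rightarrow> real) \<Rightarrow> 'a \<Rightarrow> 'a" where
  "gradient F x = (THE D. GDERIV F x :> D)"

text \<open>In both definitions, \<open>F\<close> is understood to be locally Lipschitz. The space \<open>\<real>\<^sup>N\<close> is any
  Euclidean space of dimension \<open>N\<close>, and derivatives are linear maps instead of Jacobian matrices, so
  that nonsingularity is bijectivity. That the points \<open>zs k\<close> lie in the set of
  differentiability points of \<open>F\<close>, with \<open>J k\<close> the derivative there, is expressed by
  \<open>has_derivative\<close>.\<close>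
definition B_subdifferential ::
    "('a::euclidean_space \<Rightarrow> 'a) \<Rightarrow> 'a \<Rightarrow> ('a \<Rightarrow>\<^sub>L 'a) set" where
  "B_subdifferential F z =
     {H. \<exists>(zs :: nat \<Rightarrow> 'a) (J :: nat \<Rightarrow> 'a \<Rightarrow>\<^sub>L 'a).
           (\<forall>k. (F has_derivative blinfun_apply (J k)) (at (zs k))) \<and>
           zs \<longlonglongrightarrow> z \<and> J \<longlonglongrightarrow> H}"

definition BD_regular :: "('a::euclidean_space \<Rightarrow> 'a) \<Rightarrow> 'a \<Rightarrow> bool" where
  "BD_regular F z \<longleftrightarrow> (\<forall>H \<in> B_subdifferential F z. bij (blinfun_apply H))"

definition \<phi>_min :: "real \<Rightarrow> real \<Rightarrow> real" where
  "\<phi>_min a b = min a b"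

definition \<phi>_FB :: "real \<Rightarrow> real \<Rightarrow> real" where
  "\<phi>_FB a b = sqrt (a\<^sup>2 + b\<^sup>2) - a - b"

definition Lagrangian_SP ::
    "(real^'n \<Rightarrow> real) \<Rightarrow> (real^'n \<Rightarrow> real^'m) \<Rightarrow> (real^'n \<Rightarrow> real^'p) \<Rightarrow>
     real^'n \<Rightarrow> real^'m \<Rightarrow> real^'p \<Rightarrow> real" where
  "Lagrangian_SP f g h x lam \<mu> = f x + lam \<bullet> g x + \<mu> \<bullet> h x"

definition \<Phi> ::
    "(real \<Rightarrow> real \<Rightarrow> real) \<Rightarrow> (real^'n \<Rightarrow> real^'m) \<Rightarrow> real^'n \<Rightarrow> real^'m \<Rightarrow> real^'m" where
  "\<Phi> \<phi> g x lam = (\<chi> i. \<phi> (- (g x $ i)) (lam $ i))"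

text \<open>On vectors, \<open>*\<close> is the componentwise product and \<open>1\<close> is the all-ones vector \<open>e\<close>.\<close>

definition T ::
    "real \<Rightarrow> (real \<Rightarrow> real \<Rightarrow> real) \<Rightarrow>
     (real^'n \<Rightarrow> real) \<Rightarrow> (real^'n \<Rightarrow> real^'m) \<Rightarrow> (real^'n \<Rightarrow> real^'p) \<Rightarrow>
     (real^'n) \<times> (real^'n) \<times> (real^'m) \<times> (real^'p) \<times> (real^'n) \<Rightarrow>
     (real^'n) \<times> (real^'n) \<times> (real^'m) \<times> (real^'p) \<times> (real^'n)" where
  "T \<rho> \<phi> f g h = (\<lambda>(x, y, lam, \<mu>, \<gamma>).
     (gradient (\<lambda>x. Lagrangian_SP f g h x lam \<mu>) x + \<gamma> * y,
      \<rho> *\<^sub>R (y - 1) + \<gamma> * x,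
      \<Phi> \<phi> g x lam,
      h x,
      x * y))"

definition T_red ::
    "real \<Rightarrow> (real \<Rightarrow> real \<Rightarrow> real) \<Rightarrow>
     (real^'n \<Rightarrow> real) \<Rightarrow> (real^'n \<Rightarrow> real^'m) \<Rightarrow> (real^'n \<Rightarrow> real^'p) \<Rightarrow>
     (real^'n) \<times> (real^'m) \<times> (real^'p) \<times> (real^'n) \<Rightarrow>
     (real^'n) \<times> (real^'m) \<times> (real^'p) \<times> (real^'n)" where
  "T_red \<rho> \<phi> f g h = (\<lambda>(x, lam, \<mu>, \<gamma>).
     (gradient (\<lambda>x. Lagrangian_SP f g h x lam \<mu>) x + \<gamma> * (1 - (\<gamma> * x) /\<^sub>R \<rho>),
      \<Phi> \<phi> g x lam,
      h x,
      x * (1 - (\<gamma> * x) /\<^sub>R \<rho>)))"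

end

theory Submission
  imports Defs
begin

text \<open>Both operators have the form \<open>P z + E (\<Phi> (\<pi> z))\<close>: \<open>P\<close> is continuously differentiable, because
  \<open>f\<close>, \<open>g\<close>, \<open>h\<close> are twice continuously differentiable; \<open>\<pi>\<close> is the projection to the variables
  \<open>(x, lam)\<close>; and \<open>E\<close> embeds the values of \<open>\<Phi>\<close> as one block. Since \<open>P'\<close> is continuous, passing to
  the limit concerns \<open>\<Phi>\<close> only, and the B-subdifferential at \<open>z\<close> consists of the maps
  \<open>P' z + E \<circ> A \<circ> \<pi>\<close>, where \<open>A\<close> is any limit of derivatives of \<open>\<Phi>\<close> at \<open>\<pi> z\<close>
  (\<open>B_subdifferential_smooth_plus_nonsmooth\<close>). The set of these \<open>A\<close> depends only on \<open>(x, lam)\<close>, so it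
  is the same for \<open>T\<close> and \<open>T_red\<close>.

  It remains to compare, for each \<open>A\<close>, the kernels of two linear maps. A direction
  \<open>(dx, dy, dl, dm, dg)\<close> annihilates the second block of \<open>T\<close> iff \<open>dy = - (\<gamma> * dx + dg * x) / \<rho>\<close>,
  and substituting this \<open>dy\<close> in the other blocks yields the linear map belonging to \<open>T_red\<close>, because
  \<open>y = 1 - \<gamma> * x / \<rho>\<close>. Hence one kernel is trivial iff the other is.\<close>

section \<open>The B-subdifferential of a smooth plus a nonsmooth map\<close>

text \<open>The B-subdifferential for maps between possibly different spaces, such as
  \<open>\<Phi> : \<real>\<^sup>n \<times> \<real>\<^sup>m \<rightarrow> \<real>\<^sup>m\<close>.\<close>
definition limiting_derivatives ::
    "('a::euclidean_space \<Rightarrow> 'b::euclidean_space) \<Rightarrow> 'a \<Rightarrow> ('a \<Rightarrow>\<^sub>L 'b) set" where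
  "limiting_derivatives G u =
     {A. \<exists>(us :: nat \<Rightarrow> 'a) (B :: nat \<Rightarrow> 'a \<Rightarrow>\<^sub>L 'b).
           (\<forall>k. (G has_derivative blinfun_apply (B k)) (at (us k))) \<and>
           us \<longlonglongrightarrow> u \<and> B \<longlonglongrightarrow> A}"

text \<open>The left inverse \<open>R\<close> of \<open>E\<close> and the right inverse \<open>\<iota>\<close> of \<open>\<pi>\<close> make \<open>G\<close> recoverable from \<open>F\<close>
  and \<open>P\<close>, so that \<open>F\<close> is differentiable at \<open>u\<close> exactly when \<open>G\<close> is differentiable at \<open>\<pi> u\<close>.\<close>
lemma B_subdifferential_smooth_plus_nonsmooth:
  fixes F P :: "'a::euclidean_space \<Rightarrow> 'a" and G :: "'b::euclidean_space \<Rightarrow> 'c::euclidean_space"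
    and P' :: "'a \<Rightarrow> 'a \<Rightarrow>\<^sub>L 'a" and E :: "'c \<Rightarrow>\<^sub>L 'a" and R :: "'a \<Rightarrow>\<^sub>L 'c"
    and \<pi> :: "'a \<Rightarrow>\<^sub>L 'b" and \<iota> :: "'b \<Rightarrow>\<^sub>L 'a"
  assumes F: "\<And>u. F u = P u + E (G (\<pi> u))"
    and P: "\<And>u. (P has_derivative P' u) (at u)" and cont: "isCont P' z"
    and RE: "\<And>c. R (E c) = c" and \<pi>\<iota>: "\<And>b. \<pi> (\<iota> b) = b"
  shows "B_subdifferential F z =
           (\<lambda>A. P' z + (E o\<^sub>L A o\<^sub>L \<pi>)) ` limiting_derivatives G (\<pi> z)"
proof -
  have dF: "(F has_derivative blinfun_apply (P' u + (E o\<^sub>L A o\<^sub>L \<pi>))) (at u)"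
    if "(G has_derivative blinfun_apply A) (at (\<pi> u))" for u A
  proof -
    have 1: "((\<lambda>v. G (\<pi> v)) has_derivative (\<lambda>v. A (\<pi> v))) (at u)"
      by (rule has_derivative_compose[of "blinfun_apply \<pi>" "blinfun_apply \<pi>", OF _ that])
        (rule bounded_linear_imp_has_derivative[OF blinfun.bounded_linear_right])
    have "((\<lambda>v. P v + E (G (\<pi> v))) has_derivative (\<lambda>v. P' u v + E (A (\<pi> v)))) (at u)"
      by (intro has_derivative_add P bounded_linear.has_derivative[OF blinfun.bounded_linear_right 1])
    then show ?thesis
      by (simp add: F[abs_def] blinfun.add_left[abs_def])
  qed
  show ?thesis
  proof (intro equalityI subsetI)
    fix H assume "H \<in> B_subdifferential F z"
    then obtain zs J where J: "\<And>k. (F has_derivative blinfun_apply (J k)) (at (zs k))"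
      and zs: "zs \<longlonglongrightarrow> z" and lim: "J \<longlonglongrightarrow> H"
      unfolding B_subdifferential_def by auto
    define B where "B = (\<lambda>k. R o\<^sub>L (J k - P' (zs k)) o\<^sub>L \<iota>)"
    \<comment> \<open>\<open>G\<close> is recovered from \<open>F\<close> along the affine section of \<open>\<pi>\<close> through \<open>zs k\<close>.\<close>
    have B: "(G has_derivative blinfun_apply (B k)) (at (\<pi> (zs k)))" for k
    proof -
      define s where "s = (\<lambda>u. zs k + \<iota> (u - \<pi> (zs k)))"
      have s: "(s has_derivative \<iota>) (at (\<pi> (zs k)))"
        unfolding s_def
        by (auto intro!: derivative_eq_intros
            bounded_linear.has_derivative[OF blinfun.bounded_linear_right])
      have sz: "s (\<pi> (zs k)) = zs k"
        by (simp add: s_def blinfun.zero_right)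
      have \<pi>s: "\<pi> (s u) = u" for u
        by (simp add: s_def blinfun.add_right blinfun.diff_right \<pi>\<iota>)
      have "((\<lambda>u. F (s u) - P (s u)) has_derivative (\<lambda>u. J k (\<iota> u) - P' (zs k) (\<iota> u)))
              (at (\<pi> (zs k)))"
        by (intro has_derivative_diff has_derivative_compose[OF s]) (simp_all add: sz J P)
      then have "((\<lambda>u. R (F (s u) - P (s u))) has_derivative
              (\<lambda>u. R (J k (\<iota> u) - P' (zs k) (\<iota> u)))) (at (\<pi> (zs k)))"
        by (rule bounded_linear.has_derivative[OF blinfun.bounded_linear_right])
      moreover have "blinfun_apply (B k) = (\<lambda>u. R (J k (\<iota> u) - P' (zs k) (\<iota> u)))"
        by (simp add: fun_eq_iff B_def blinfun.diff_left)
      ultimately show ?thesis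
        by (simp add: F \<pi>s RE)
    qed
    have P'lim: "(\<lambda>k. P' (zs k)) \<longlonglongrightarrow> P' z"
      by (rule isCont_tendsto_compose[OF cont zs])
    have Blim: "B \<longlonglongrightarrow> (R o\<^sub>L (H - P' z) o\<^sub>L \<iota>)"
      unfolding B_def by (intro tendsto_intros lim P'lim)
    have "(\<lambda>k. \<pi> (zs k)) \<longlonglongrightarrow> \<pi> z"
      by (intro tendsto_intros zs)
    with B Blim have mem: "(R o\<^sub>L (H - P' z) o\<^sub>L \<iota>) \<in> limiting_derivatives G (\<pi> z)"
      unfolding limiting_derivatives_def by (intro CollectI exI[of _ "\<lambda>k. \<pi> (zs k)"] exI[of _ B]) simp
    have "J k = P' (zs k) + (E o\<^sub>L B k o\<^sub>L \<pi>)" for k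
      using has_derivative_unique[OF J dF[OF B]] by (simp add: blinfun_apply_inject)
    then have "J = (\<lambda>k. P' (zs k) + (E o\<^sub>L B k o\<^sub>L \<pi>))" by blast
    moreover have "(\<lambda>k. P' (zs k) + (E o\<^sub>L B k o\<^sub>L \<pi>)) \<longlonglongrightarrow>
        P' z + (E o\<^sub>L (R o\<^sub>L (H - P' z) o\<^sub>L \<iota>) o\<^sub>L \<pi>)"
      by (intro tendsto_intros P'lim Blim)
    ultimately have "H = P' z + (E o\<^sub>L (R o\<^sub>L (H - P' z) o\<^sub>L \<iota>) o\<^sub>L \<pi>)"
      using lim LIMSEQ_unique by blast
    with mem show "H \<in> (\<lambda>A. P' z + (E o\<^sub>L A o\<^sub>L \<pi>)) ` limiting_derivatives G (\<pi> z)"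
      by (rule rev_image_eqI)
  next
    fix H assume "H \<in> (\<lambda>A. P' z + (E o\<^sub>L A o\<^sub>L \<pi>)) ` limiting_derivatives G (\<pi> z)"
    then obtain A us B where H: "H = P' z + (E o\<^sub>L A o\<^sub>L \<pi>)"
      and B: "\<And>k. (G has_derivative blinfun_apply (B k)) (at (us k))"
      and us: "us \<longlonglongrightarrow> \<pi> z" and lim: "B \<longlonglongrightarrow> A"
      unfolding limiting_derivatives_def by auto
    \<comment> \<open>A sequence near \<open>\<pi> z\<close> is lifted through the affine section of \<open>\<pi>\<close> through \<open>z\<close>.\<close>
    define zs where "zs = (\<lambda>k. z + \<iota> (us k - \<pi> z))"
    have \<pi>zs: "\<pi> (zs k) = us k" for k
      by (simp add: zs_def blinfun.add_right blinfun.diff_right \<pi>\<iota>)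
    have "zs \<longlonglongrightarrow> z + \<iota> (\<pi> z - \<pi> z)"
      unfolding zs_def by (intro tendsto_intros us)
    then have zs: "zs \<longlonglongrightarrow> z" by (simp add: blinfun.zero_right)
    have "(\<lambda>k. P' (zs k) + (E o\<^sub>L B k o\<^sub>L \<pi>)) \<longlonglongrightarrow> H"
      unfolding H by (intro tendsto_intros isCont_tendsto_compose[OF cont zs] lim)
    moreover have "(F has_derivative blinfun_apply (P' (zs k) + (E o\<^sub>L B k o\<^sub>L \<pi>))) (at (zs k))" for k
      by (rule dF) (simp add: \<pi>zs B)
    ultimately show "H \<in> B_subdifferential F z"
      using zs unfolding B_subdifferential_def
      by (intro CollectI exI[of _ zs] exI[of _ "\<lambda>k. P' (zs k) + (E o\<^sub>L B k o\<^sub>L \<pi>)"]) simp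
  qed
qed

lemma bij_iff_trivial_kernel:
  fixes f :: "'a::euclidean_space \<Rightarrow> 'a"
  assumes "linear f"
  shows "bij f \<longleftrightarrow> (\<forall>d. f d = 0 \<longrightarrow> d = 0)"
  using assms linear_injective_0[of f] linear_injective_imp_surjective[of f]
  by (auto simp: bij_def)

text \<open>The same result for linear maps given as functions, with nonsingularity expressed by the kernel.\<close>
lemma BD_regular_smooth_plus_nonsmooth_iff:
  fixes F P :: "'a::euclidean_space \<Rightarrow> 'a" and G :: "'b::euclidean_space \<Rightarrow> 'c::euclidean_space"
  assumes F: "\<And>u. F u = P u + E (G (\<pi> u))"
    and P: "\<And>u. (P has_derivative D u) (at u)" and cont: "\<And>d. isCont (\<lambda>u. D u d) z"
    and lin: "bounded_linear E" "bounded_linear R" "bounded_linear \<pi>" "bounded_linear \<iota>"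
    and RE: "\<And>c. R (E c) = c" and \<pi>\<iota>: "\<And>b. \<pi> (\<iota> b) = b"
  shows "BD_regular F z \<longleftrightarrow>
    (\<forall>A \<in> limiting_derivatives G (\<pi> z). \<forall>d. D z d + E (blinfun_apply A (\<pi> d)) = 0 \<longrightarrow> d = 0)"
proof -
  note ap = lin[THEN bounded_linear_Blinfun_apply]
  define P' where "P' u = Blinfun (D u)" for u
  have P': "blinfun_apply (P' u) = D u" for u
    unfolding P'_def by (rule bounded_linear_Blinfun_apply[OF has_derivative_bounded_linear[OF P]])
  have "isCont P' z"
    by (rule continuous_blinfun_componentwiseI1) (simp add: P' cont)
  then have "B_subdifferential F z =
      (\<lambda>A. P' z + (Blinfun E o\<^sub>L A o\<^sub>L Blinfun \<pi>)) ` limiting_derivatives G (Blinfun \<pi> z)"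
    by (intro B_subdifferential_smooth_plus_nonsmooth[where R = "Blinfun R" and \<iota> = "Blinfun \<iota>"])
      (use P in \<open>simp_all add: ap F P' RE \<pi>\<iota>\<close>)
  then show ?thesis
    by (simp add: BD_regular_def bij_iff_trivial_kernel[OF bounded_linear.linear[OF
            blinfun.bounded_linear_right]] ap P' blinfun.add_left)
qed

section \<open>Componentwise products and the gradient of the Lagrangian\<close>

lemma bounded_bilinear_vec_mult: "bounded_bilinear ((*) :: real^'n \<Rightarrow> real^'n \<Rightarrow> real^'n)"
  unfolding bilinear_conv_bounded_bilinear[symmetric] bilinear_def
  by (auto intro!: linearI simp: vec_eq_iff algebra_simps)

lemmas has_derivative_vec_mult [derivative_intros] =
  bounded_bilinear.FDERIV[OF bounded_bilinear_vec_mult]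

lemmas isCont_vec_mult [continuous_intros] =
  bounded_bilinear.isCont[OF bounded_bilinear_vec_mult]

lemma gradient_eq_sum_Basis:
  fixes F :: "'a::euclidean_space \<Rightarrow> real"
  assumes "(F has_derivative F') (at x)"
  shows "gradient F x = (\<Sum>b\<in>Basis. F' b *\<^sub>R b)"
proof -
  interpret F': bounded_linear F' using assms by (rule has_derivative_bounded_linear)
  have rep: "F' = (\<lambda>d. d \<bullet> (\<Sum>b\<in>Basis. F' b *\<^sub>R b))"
  proof
    fix d
    have "F' d = F' (\<Sum>b\<in>Basis. (d \<bullet> b) *\<^sub>R b)" by (simp add: euclidean_representation)
    also have "\<dots> = d \<bullet> (\<Sum>b\<in>Basis. F' b *\<^sub>R b)"
      by (simp add: F'.sum F'.scaleR inner_sum_right mult.commute)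
    finally show "F' d = d \<bullet> (\<Sum>b\<in>Basis. F' b *\<^sub>R b)" .
  qed
  show ?thesis
    unfolding gradient_def
  proof (rule the_equality)
    show "GDERIV F x :> (\<Sum>b\<in>Basis. F' b *\<^sub>R b)"
      using assms rep unfolding gderiv_def by metis
  next
    fix D assume "GDERIV F x :> D"
    then have "(\<lambda>d. d \<bullet> D) = F'"
      unfolding gderiv_def using assms by (rule has_derivative_unique)
    then have "(\<lambda>d. d \<bullet> D) = (\<lambda>d. d \<bullet> (\<Sum>b\<in>Basis. F' b *\<^sub>R b))" using rep by simp
    then show "D = (\<Sum>b\<in>Basis. F' b *\<^sub>R b)"
      by (metis vector_eq_ldot)
  qed
qed

text \<open>Written out in the standard basis, the \<open>b\<close>-component of the gradient is
  \<open>f' x b + lam \<bullet> g' x b + \<mu> \<bullet> h' x b\<close>, which is continuously differentiable jointly in \<open>x\<close>, \<open>lam\<close> and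
  \<open>\<mu>\<close>. Continuity of the derivative is stated for each fixed direction; on a Euclidean space this
  amounts to continuity in the operator norm.\<close>
lemma gradient_Lagrangian_SP_C1:
  fixes f :: "real^'n \<Rightarrow> real" and g :: "real^'n \<Rightarrow> real^'m" and h :: "real^'n \<Rightarrow> real^'p"
  assumes "twice_cont_differentiable f" "twice_cont_differentiable g" "twice_cont_differentiable h"
  obtains N' where
    "\<And>w. ((\<lambda>(x, lam, \<mu>). gradient (\<lambda>x. Lagrangian_SP f g h x lam \<mu>) x) has_derivative N' w) (at w)"
    "\<And>d. continuous_on UNIV (\<lambda>w. N' w d)"
proof -
  from assms(1) obtain f' f'' where f: "\<And>x. (f has_derivative blinfun_apply (f' x)) (at x)"
    "\<And>x. (f' has_derivative blinfun_apply (f'' x)) (at x)" "continuous_on UNIV f''"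
    unfolding twice_cont_differentiable_def by blast
  from assms(2) obtain g' g'' where g: "\<And>x. (g has_derivative blinfun_apply (g' x)) (at x)"
    "\<And>x. (g' has_derivative blinfun_apply (g'' x)) (at x)" "continuous_on UNIV g''"
    unfolding twice_cont_differentiable_def by blast
  from assms(3) obtain h' h'' where h: "\<And>x. (h has_derivative blinfun_apply (h' x)) (at x)"
    "\<And>x. (h' has_derivative blinfun_apply (h'' x)) (at x)" "continuous_on UNIV h''"
    unfolding twice_cont_differentiable_def by blast
  have cont': "continuous_on UNIV f'" "continuous_on UNIV g'" "continuous_on UNIV h'"
    by (rule has_derivative_continuous_on, rule has_derivative_at_withinI, rule f(2) g(2) h(2))+
  let ?N = "\<lambda>w. \<Sum>b\<in>Basis. (f' (fst w) b + fst (snd w) \<bullet> g' (fst w) b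
                              + snd (snd w) \<bullet> h' (fst w) b) *\<^sub>R b"
  let ?N' = "\<lambda>w d. \<Sum>b\<in>Basis. (f'' (fst w) (fst d) b
      + (fst (snd w) \<bullet> g'' (fst w) (fst d) b + fst (snd d) \<bullet> g' (fst w) b)
      + (snd (snd w) \<bullet> h'' (fst w) (fst d) b + snd (snd d) \<bullet> h' (fst w) b)) *\<^sub>R b"
  have "gradient (\<lambda>x. Lagrangian_SP f g h x lam \<mu>) x = ?N (x, lam, \<mu>)" for x lam \<mu>
    unfolding Lagrangian_SP_def fst_conv snd_conv
    by (rule gradient_eq_sum_Basis) (auto intro!: derivative_eq_intros f(1) g(1) h(1))
  then have eq: "(\<lambda>(x, lam, \<mu>). gradient (\<lambda>x. Lagrangian_SP f g h x lam \<mu>) x) = ?N"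
    by (auto simp: fun_eq_iff)
  have app: "((\<lambda>w. k' (fst w) b) has_derivative (\<lambda>d. k'' (fst w) (fst d) b)) (at w)"
    if k: "\<And>x. (k' has_derivative blinfun_apply (k'' x)) (at x)"
    for k' :: "real^'n \<Rightarrow> (real^'n) \<Rightarrow>\<^sub>L 'z::real_normed_vector" and k'' b
      and w :: "(real^'n) \<times> (real^'m) \<times> (real^'p)"
  proof -
    have "((\<lambda>w. k' (fst w)) has_derivative (\<lambda>d. k'' (fst w) (fst d))) (at w)"
      by (rule has_derivative_compose[OF _ k]) (auto intro!: derivative_eq_intros)
    then show ?thesis
      by (rule bounded_linear.has_derivative[OF blinfun.bounded_linear_left])
  qed
  show ?thesis
  proof (rule that[of ?N'])
    show "((\<lambda>(x, lam, \<mu>). gradient (\<lambda>x. Lagrangian_SP f g h x lam \<mu>) x) has_derivative ?N' w) (at w)"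
      for w unfolding eq
      by (intro derivative_intros app f g h)
    show "continuous_on UNIV (\<lambda>w. ?N' w d)" for d
      by (intro continuous_intros continuous_on_compose2[OF f(3)] continuous_on_compose2[OF g(3)]
          continuous_on_compose2[OF h(3)] continuous_on_compose2[OF cont'(1)]
          continuous_on_compose2[OF cont'(2)] continuous_on_compose2[OF cont'(3)]) auto
  qed
qed

lemma twice_cont_differentiable_imp_C1:
  fixes h :: "'a::real_normed_vector \<Rightarrow> 'b::real_normed_vector"
  assumes "twice_cont_differentiable h"
  obtains h' where "\<And>x. (h has_derivative h' x) (at x)" "\<And>d. continuous_on UNIV (\<lambda>x. h' x d)"
proof -
  from assms obtain h' h'' where h: "\<And>x. (h has_derivative blinfun_apply (h' x)) (at x)"
    "\<And>x. (h' has_derivative blinfun_apply (h'' x)) (at x)"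
    unfolding twice_cont_differentiable_def by blast
  have "continuous_on UNIV h'"
    by (rule has_derivative_continuous_on, rule has_derivative_at_withinI, rule h(2))
  then show ?thesis
    by (intro that[of "\<lambda>x. blinfun_apply (h' x)"] h continuous_intros)
qed

section \<open>Equivalence of BD-regularity\<close>

theorem theorem6p2:
  fixes \<rho> :: real
    and \<phi> :: "real \<Rightarrow> real \<Rightarrow> real"
    and f :: "real^'n \<Rightarrow> real"
    and g :: "real^'n \<Rightarrow> real^'m"
    and h :: "real^'n \<Rightarrow> real^'p"
    and x y \<gamma> :: "real^'n"
    and lam :: "real^'m"
    and \<mu> :: "real^'p"
  assumes "\<rho> > 0"
    and "twice_cont_differentiable f"
    and "twice_cont_differentiable g"
    and "twice_cont_differentiable h"
    and "\<phi> = \<phi>_min \<or> \<phi> = \<phi>_FB"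
    and "y = 1 - (\<gamma> * x) /\<^sub>R \<rho>"
  shows "BD_regular (T \<rho> \<phi> f g h) (x, y, lam, \<mu>, \<gamma>) \<longleftrightarrow>
         BD_regular (T_red \<rho> \<phi> f g h) (x, lam, \<mu>, \<gamma>)"
proof -
  let ?N = "\<lambda>(x, lam, \<mu>). gradient (\<lambda>x. Lagrangian_SP f g h x lam \<mu>) x"
  let ?G = "\<lambda>u. \<Phi> \<phi> g (fst u) (snd u)"
  obtain N' where N: "\<And>w. (?N has_derivative N' w) (at w)"
    and cN: "\<And>d. continuous_on UNIV (\<lambda>w. N' w d)"
    using gradient_Lagrangian_SP_C1[OF assms(2-4)] by blast
  obtain h' where h: "\<And>x. (h has_derivative h' x) (at x)"
    and ch: "\<And>d. continuous_on UNIV (\<lambda>x. h' x d)"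
    using twice_cont_differentiable_imp_C1[OF assms(4)] by blast
  note N_comp = has_derivative_compose[OF _ N] and h_comp = has_derivative_compose[OF _ h]
  have cN': "isCont (\<lambda>w. N' (k w) d) w" if "isCont k w" for k d w
    by (rule isCont_o2[OF that]) (use cN in \<open>metis continuous_on_eq_continuous_at open_UNIV UNIV_I\<close>)
  have ch': "isCont (\<lambda>w. h' (k w) d) w" if "isCont k w" for k d w
    by (rule isCont_o2[OF that]) (use ch in \<open>metis continuous_on_eq_continuous_at open_UNIV UNIV_I\<close>)
  have T: "BD_regular (T \<rho> \<phi> f g h) (x, y, lam, \<mu>, \<gamma>) \<longleftrightarrow>
      (\<forall>A \<in> limiting_derivatives ?G (x, lam). \<forall>dx dy dl dm dg.
         N' (x, lam, \<mu>) (dx, dl, dm) + (\<gamma> * dy + dg * y) = 0 \<and>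
         \<rho> *\<^sub>R dy + (\<gamma> * dx + dg * x) = 0 \<and> A (dx, dl) = 0 \<and> h' x dx = 0 \<and> x * dy + dx * y = 0 \<longrightarrow>
         dx = 0 \<and> dy = 0 \<and> dl = 0 \<and> dm = 0 \<and> dg = 0)"
  proof -
    \<comment> \<open>\<open>?P\<close> is \<open>T\<close> with the block \<open>\<Phi>\<close> replaced by zero, and \<open>?D\<close> is its derivative.\<close>
    let ?P = "\<lambda>z. (?N (fst z, fst (snd (snd z)), fst (snd (snd (snd z))))
          + snd (snd (snd (snd z))) * fst (snd z),
        \<rho> *\<^sub>R (fst (snd z) - 1) + snd (snd (snd (snd z))) * fst z,
        0 :: real^'m, h (fst z), fst z * fst (snd z))"
    let ?D = "\<lambda>z d. (N' (fst z, fst (snd (snd z)), fst (snd (snd (snd z))))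
            (fst d, fst (snd (snd d)), fst (snd (snd (snd d))))
          + (snd (snd (snd (snd z))) * fst (snd d) + snd (snd (snd (snd d))) * fst (snd z)),
        \<rho> *\<^sub>R fst (snd d) + (snd (snd (snd (snd z))) * fst d + snd (snd (snd (snd d))) * fst z),
        0 :: real^'m, h' (fst z) (fst d), fst z * fst (snd d) + fst d * fst (snd z))"
    have "BD_regular (T \<rho> \<phi> f g h) (x, y, lam, \<mu>, \<gamma>) \<longleftrightarrow>
      (\<forall>A \<in> limiting_derivatives ?G ((\<lambda>z. (fst z, fst (snd (snd z)))) (x, y, lam, \<mu>, \<gamma>)).
        \<forall>d. ?D (x, y, lam, \<mu>, \<gamma>) d + (\<lambda>c. (0, 0, c, 0, 0)) (A (fst d, fst (snd (snd d)))) = 0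
          \<longrightarrow> d = 0)"
    proof (rule BD_regular_smooth_plus_nonsmooth_iff[where P = ?P
          and R = "\<lambda>z. fst (snd (snd z))" and \<iota> = "\<lambda>u. (fst u, 0, snd u, 0, 0)"])
      show "(?P has_derivative ?D z) (at z)" for z
        by (rule has_derivative_eq_rhs, (rule N_comp h_comp derivative_intros)+) simp
      show "isCont (\<lambda>z. ?D z d) (x, y, lam, \<mu>, \<gamma>)" for d
        by (intro continuous_intros cN' ch' isCont_vec_mult)
    qed (auto simp: T_def intro!: bounded_linear_intros)
    then show ?thesis by (simp add: zero_prod_def)
  qed
  have T_red: "BD_regular (T_red \<rho> \<phi> f g h) (x, lam, \<mu>, \<gamma>) \<longleftrightarrow>
      (\<forall>A \<in> limiting_derivatives ?G (x, lam). \<forall>dx dl dm dg.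
         N' (x, lam, \<mu>) (dx, dl, dm) + (\<gamma> * - ((\<gamma> * dx + dg * x) /\<^sub>R \<rho>) + dg * y) = 0 \<and>
         A (dx, dl) = 0 \<and> h' x dx = 0 \<and> x * - ((\<gamma> * dx + dg * x) /\<^sub>R \<rho>) + dx * y = 0 \<longrightarrow>
         dx = 0 \<and> dl = 0 \<and> dm = 0 \<and> dg = 0)"
  proof -
    \<comment> \<open>\<open>?dy\<close> is the derivative of the eliminated variable \<open>?y\<close>.\<close>
    let ?y = "\<lambda>w. 1 - (snd (snd (snd w)) * fst w) /\<^sub>R \<rho>"
    let ?dy = "\<lambda>w d. - ((snd (snd (snd w)) * fst d + snd (snd (snd d)) * fst w) /\<^sub>R \<rho>)"
    let ?P = "\<lambda>w. (?N (fst w, fst (snd w), fst (snd (snd w))) + snd (snd (snd w)) * ?y w,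
        0 :: real^'m, h (fst w), fst w * ?y w)"
    let ?D = "\<lambda>w d. (N' (fst w, fst (snd w), fst (snd (snd w)))
            (fst d, fst (snd d), fst (snd (snd d)))
          + (snd (snd (snd w)) * ?dy w d + snd (snd (snd d)) * ?y w),
        0 :: real^'m, h' (fst w) (fst d), fst w * ?dy w d + fst d * ?y w)"
    have "BD_regular (T_red \<rho> \<phi> f g h) (x, lam, \<mu>, \<gamma>) \<longleftrightarrow>
      (\<forall>A \<in> limiting_derivatives ?G ((\<lambda>w. (fst w, fst (snd w))) (x, lam, \<mu>, \<gamma>)).
        \<forall>d. ?D (x, lam, \<mu>, \<gamma>) d + (\<lambda>c. (0, c, 0, 0)) (A (fst d, fst (snd d))) = 0 \<longrightarrow> d = 0)"
    proof (rule BD_regular_smooth_plus_nonsmooth_iff[where P = ?P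
          and R = "\<lambda>w. fst (snd w)" and \<iota> = "\<lambda>u. (fst u, snd u, 0, 0)"])
      show "(?P has_derivative ?D w) (at w)" for w
        by (rule has_derivative_eq_rhs, (rule N_comp h_comp derivative_intros)+) simp
      show "isCont (\<lambda>w. ?D w d) (x, lam, \<mu>, \<gamma>)" for d
        by (intro continuous_intros cN' ch' isCont_vec_mult)
    qed (auto simp: T_red_def intro!: bounded_linear_intros)
    then show ?thesis by (simp add: zero_prod_def assms(6))
  qed
  \<comment> \<open>As \<open>\<rho> \<noteq> 0\<close>, the second block of the kernel equations for \<open>T\<close> can be solved for \<open>dy\<close>.\<close>
  have elim: "\<rho> *\<^sub>R a + b = 0 \<longleftrightarrow> a = - (b /\<^sub>R \<rho>)" for a b :: "real^'n"
    using assms(1) real_vector_affinity_eq[of \<rho> a b 0] by simp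
  \<comment> \<open>\<open>s dx dg\<close> is the value of \<open>dy\<close> forced by the second block, and \<open>K\<close> collects the other blocks,
    which turn into the equations for \<open>T_red\<close> when \<open>dy = s dx dg\<close>.\<close>
  define K where "K A dx dy dl dm dg \<longleftrightarrow>
      N' (x, lam, \<mu>) (dx, dl, dm) + (\<gamma> * dy + dg * y) = 0 \<and>
      blinfun_apply A (dx, dl) = 0 \<and> h' x dx = 0 \<and> x * dy + dx * y = 0"
    for A :: "((real^'n) \<times> (real^'m)) \<Rightarrow>\<^sub>L (real^'m)" and dx dy dl dm dg
  define s where "s dx dg = - ((\<gamma> * dx + dg * x) /\<^sub>R \<rho>)" for dx dg
  have s0: "s 0 0 = 0"
    by (simp add: s_def)
  have T': "BD_regular (T \<rho> \<phi> f g h) (x, y, lam, \<mu>, \<gamma>) \<longleftrightarrow>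
      (\<forall>A \<in> limiting_derivatives ?G (x, lam). \<forall>dx dy dl dm dg.
         dy = s dx dg \<and> K A dx dy dl dm dg \<longrightarrow> dx = 0 \<and> dy = 0 \<and> dl = 0 \<and> dm = 0 \<and> dg = 0)"
    unfolding T elim K_def s_def by (simp only: conj_ac)
  have T_red': "BD_regular (T_red \<rho> \<phi> f g h) (x, lam, \<mu>, \<gamma>) \<longleftrightarrow>
      (\<forall>A \<in> limiting_derivatives ?G (x, lam). \<forall>dx dl dm dg.
         K A dx (s dx dg) dl dm dg \<longrightarrow> dx = 0 \<and> dl = 0 \<and> dm = 0 \<and> dg = 0)"
    unfolding T_red K_def s_def by (rule refl)
  show ?thesis
    unfolding T' T_red' using s0 by (intro ball_cong refl) blast
qed

end
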